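(* Let $U_1,\dots,U_m\subset\mathbb{R}^n$ be nonempty closed convex sets with $U:=\bigcap_{i=1}^m U_i\neq\emptyset$. For any starting point $x_1\in\mathbb{R}^n$, the sequence $(x_k)_{k\ge 1}$ generated by 3PM converges to a point $\bar x\in U$.
   Context: $\mathbb{R}^n$ carries the Euclidean inner product and norm; $P_C(x)$ denotes the projection (nearest point) of $x$ onto a nonempty closed convex set $C$. The sequence generated by 3PM (Parallel Polyhedral Projection Method) from $x_1$ is defined recursively for $k\ge1$ by $$S_{ik}=\{z\in\mathbb{R}^n:\langle x_k-P_{U_i}(x_k),\,z-P_{U_i}(x_k)\rangle\le 0\}\ (i=1,\dots,m),\quad \Omega_k=\bigcap_{i=1}^m S_{ik},\quad x_{k+1}=P_{\Omega_k}(x_k).$$ (Each $S_{ik}\supset U_i$, and $S_{ik}=\mathbb{R}^n$ if $x_k\in U_i$. If $x_k\in U$, then $x_{k+1}=x_k$, so the sequence is constant from then on.) *)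

theory Defs
  imports "HOL-Analysis.Analysis"
begin

definition supporting_halfspace :: "'a::euclidean_space set \<Rightarrow> 'a \<Rightarrow> 'a set" where
  "supporting_halfspace C x =
     {z. (x - closest_point C x) \<bullet> (z - closest_point C x) \<le> 0}"

definition outer_polyhedron :: "nat \<Rightarrow> (nat \<Rightarrow> 'a::euclidean_space set) \<Rightarrow> 'a \<Rightarrow> 'a set" where
  "outer_polyhedron m U x = (\<Inter>i\<in>{1..m}. supporting_halfspace (U i) x)"

(* Indexed from 0: the iterate x_k (k = 1, 2, ...) is threePM_seq m U x1 (k - 1). *)
primrec threePM_seq ::
  "nat \<Rightarrow> (nat \<Rightarrow> 'a::euclidean_space set) \<Rightarrow> 'a \<Rightarrow> nat \<Rightarrow> 'a" where
  "threePM_seq m U x1 0 = x1"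
| "threePM_seq m U x1 (Suc k) =
     closest_point (outer_polyhedron m U (threePM_seq m U x1 k)) (threePM_seq m U x1 k)"

end

theory Submission
  imports Defs
begin

text \<open>
  Every point of the common intersection lies in each outer polyhedron, so the iterates are
  Fejer monotone with respect to it, and the squared step lengths are dominated by the decrease
  of the squared distance to a common point; hence the steps tend to zero. The next iterate lies in
  every supporting halfspace, so the distance of an iterate to each set is at most the
  length of the step. Every cluster point is therefore a common point, and Fejer
  monotonicity turns one cluster point into the limit.
\<close>

lemma subset_supporting_halfspace:
  assumes "closed C" "convex C"
  shows "C \<subseteq> supporting_halfspace C x"
  using closest_point_dot[OF assms(2,1)] by (auto simp: supporting_halfspace_def)

text \<open>Normal form \<open>a \<bullet> z \<le> b\<close>, for which closedness and convexity are
  standard. It includes the degenerate case \<open>x \<in> C\<close>, where the normal is zero and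
  the set is the whole space.\<close>

lemma supporting_halfspace_eq:
  "supporting_halfspace C x =
     {z. (x - closest_point C x) \<bullet> z \<le> (x - closest_point C x) \<bullet> closest_point C x}"
  by (auto simp: supporting_halfspace_def inner_diff_right)

lemma closed_supporting_halfspace: "closed (supporting_halfspace C x)"
  unfolding supporting_halfspace_eq by (rule closed_halfspace_le)

lemma convex_supporting_halfspace: "convex (supporting_halfspace C x)"
  unfolding supporting_halfspace_eq by (rule convex_halfspace_le)

lemma closed_outer_polyhedron: "closed (outer_polyhedron m U x)"
  unfolding outer_polyhedron_def by (auto intro: closed_supporting_halfspace)

lemma convex_outer_polyhedron: "convex (outer_polyhedron m U x)"
  unfolding outer_polyhedron_def by (auto intro: convex_INT convex_supporting_halfspace)

text \<open>Splitting \<open>x - p\<close> through \<open>y\<close> leaves a term that the halfspace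
  inequality makes nonpositive; Cauchy-Schwarz bounds the rest. This is how a step length controls
  the distance to each \<open>U i\<close>.\<close>

lemma dist_closest_point_le_supporting_halfspace:
  assumes "y \<in> supporting_halfspace C x"
  shows "dist x (closest_point C x) \<le> dist x y"
proof -
  define p where "p = closest_point C x"
  have "(norm (x - p))\<^sup>2 = (x - p) \<bullet> (x - y) + (x - p) \<bullet> (y - p)"
    by (simp add: power2_norm_eq_inner flip: inner_add_right)
  also have "\<dots> \<le> (x - p) \<bullet> (x - y)"
    using assms by (simp add: supporting_halfspace_def p_def)
  also have "\<dots> \<le> norm (x - p) * norm (x - y)"
    by (rule norm_cauchy_schwarz)
  \<comment> \<open>Cancel the factor \<open>norm (x - p)\<close>; if it is zero, the claim is
    trivial.\<close>
  finally have "norm (x - p) \<le> norm (x - y)"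
    by (cases "x = p") (auto simp: power2_eq_square)
  then show ?thesis
    by (simp add: dist_norm p_def)
qed

text \<open>The angle at the projection between \<open>x\<close> and \<open>z\<close> is not acute,
  so the cross term in the law of cosines has the favourable sign.\<close>

lemma closest_point_dist_squared_decrease:
  assumes "closed S" "convex S" "z \<in> S"
  shows "(dist (closest_point S x) z)\<^sup>2 + (dist x (closest_point S x))\<^sup>2 \<le> (dist x z)\<^sup>2"
proof -
  define p where "p = closest_point S x"
  have "(dist x z)\<^sup>2 = (dist p z)\<^sup>2 + (dist x p)\<^sup>2 - 2 * ((x - p) \<bullet> (z - p))"
    by (simp add: dist_norm power2_norm_eq_inner algebra_simps inner_commute)
  moreover have "(x - p) \<bullet> (z - p) \<le> 0"
    unfolding p_def using assms by (intro closest_point_dot)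
  ultimately show ?thesis
    by (simp add: p_def)
qed

text \<open>Bounded distances to \<open>z\<close> yield a convergent subsequence, whose limit
  \<open>l\<close> is in \<open>A\<close>. The distances to \<open>l\<close> are then themselves
  decreasing, hence convergent, and the subsequence forces their limit to be 0.\<close>

lemma Fejer_monotone_tendsto:
  fixes x :: "nat \<Rightarrow> 'a::heine_borel"
  assumes "z \<in> A"
    and Fejer: "\<And>z k. z \<in> A \<Longrightarrow> dist (x (Suc k)) z \<le> dist (x k) z"
    and cluster: "\<And>r l. strict_mono r \<Longrightarrow> (x \<circ> r) \<longlonglongrightarrow> l \<Longrightarrow> l \<in> A"
  shows "\<exists>l\<in>A. x \<longlonglongrightarrow> l"
proof -
  have decseq: "decseq (\<lambda>k. dist (x k) w)" if "w \<in> A" for w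
    using Fejer[OF that] by (rule decseq_SucI)
  have "dist z (x k) \<le> dist z (x 0)" for k
    using decseqD[OF decseq[OF assms(1)], of 0 k] by (simp add: dist_commute)
  then have "bounded (range x)"
    unfolding bounded_def by blast
  then obtain l r where r: "strict_mono r" "(x \<circ> r) \<longlonglongrightarrow> l"
    using bounded_imp_convergent_subsequence by blast
  then have l: "l \<in> A"
    by (rule cluster)
  obtain L where L: "(\<lambda>k. dist (x k) l) \<longlonglongrightarrow> L"
    using decseq_convergent[OF decseq[OF l], of 0] by auto
  have "(\<lambda>k. dist ((x \<circ> r) k) l) \<longlonglongrightarrow> L"
    using LIMSEQ_subseq_LIMSEQ[OF L r(1)] by (simp add: o_def)
  moreover have "(\<lambda>k. dist ((x \<circ> r) k) l) \<longlonglongrightarrow> 0"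
    using r(2) by (rule tendsto_dist_iff[THEN iffD1])
  ultimately have "L = 0"
    by (rule LIMSEQ_unique)
  then have "x \<longlonglongrightarrow> l"
    using L by (subst tendsto_dist_iff) simp
  then show ?thesis
    using l by blast
qed

lemma threePM_dist_squared_decrease:
  assumes "\<And>i. i \<in> {1..m} \<Longrightarrow> closed (U i)"
    and "\<And>i. i \<in> {1..m} \<Longrightarrow> convex (U i)"
    and "z \<in> (\<Inter>i\<in>{1..m}. U i)"
  shows "(dist (threePM_seq m U x1 (Suc k)) z)\<^sup>2 +
      (dist (threePM_seq m U x1 k) (threePM_seq m U x1 (Suc k)))\<^sup>2 \<le>
      (dist (threePM_seq m U x1 k) z)\<^sup>2"
proof -
  have "z \<in> outer_polyhedron m U (threePM_seq m U x1 k)"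
    unfolding outer_polyhedron_def
    using assms by (auto intro!: subsetD[OF subset_supporting_halfspace])
  then show ?thesis
    by (simp add: closest_point_dist_squared_decrease closed_outer_polyhedron
        convex_outer_polyhedron)
qed

lemma dist_threePM_closest_point_le:
  assumes "\<And>i. i \<in> {1..m} \<Longrightarrow> closed (U i)"
    and "\<And>i. i \<in> {1..m} \<Longrightarrow> convex (U i)"
    and "(\<Inter>i\<in>{1..m}. U i) \<noteq> {}" "i \<in> {1..m}"
  shows "dist (threePM_seq m U x1 k) (closest_point (U i) (threePM_seq m U x1 k)) \<le>
    dist (threePM_seq m U x1 k) (threePM_seq m U x1 (Suc k))"
proof -
  let ?S = "outer_polyhedron m U (threePM_seq m U x1 k)"
  have "(\<Inter>i\<in>{1..m}. U i) \<subseteq> ?S"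
    unfolding outer_polyhedron_def
    using assms(1,2) by (intro INT_anti_mono subset_supporting_halfspace) auto
  \<comment> \<open>Nonemptiness guarantees that \<open>closest_point\<close> really returns a point
    of the polyhedron.\<close>
  then have "?S \<noteq> {}"
    using assms(3) by blast
  then have "threePM_seq m U x1 (Suc k) \<in> ?S"
    by (simp add: closest_point_in_set closed_outer_polyhedron)
  then show ?thesis
    using assms(4) unfolding outer_polyhedron_def
    by (intro dist_closest_point_le_supporting_halfspace) blast
qed

theorem theorem2p6:
  fixes m :: nat
    and U :: "nat \<Rightarrow> (real ^ 'n) set"
    and x1 :: "real ^ 'n"
  assumes "m \<ge> 1"
    and "\<And>i. i \<in> {1..m} \<Longrightarrow> U i \<noteq> {}"
    and "\<And>i. i \<in> {1..m} \<Longrightarrow> closed (U i)"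
    and "\<And>i. i \<in> {1..m} \<Longrightarrow> convex (U i)"
    and "(\<Inter>i\<in>{1..m}. U i) \<noteq> {}"
  shows "\<exists>xbar \<in> (\<Inter>i\<in>{1..m}. U i). threePM_seq m U x1 \<longlonglongrightarrow> xbar"
proof -
  define x where "x = threePM_seq m U x1"
  obtain z where z: "z \<in> (\<Inter>i\<in>{1..m}. U i)"
    using assms(5) by blast
  have decrease: "(dist (x (Suc k)) w)\<^sup>2 + (dist (x k) (x (Suc k)))\<^sup>2 \<le> (dist (x k) w)\<^sup>2"
    if "w \<in> (\<Inter>i\<in>{1..m}. U i)" for w k
    unfolding x_def using assms(3,4) that by (rule threePM_dist_squared_decrease)
  have "decseq (\<lambda>k. (dist (x k) z)\<^sup>2)"
  proof (rule decseq_SucI)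
    show "(dist (x (Suc k)) z)\<^sup>2 \<le> (dist (x k) z)\<^sup>2" for k
      using decrease[OF z, of k] zero_le_power2[of "dist (x k) (x (Suc k))"] by linarith
  qed
  then obtain L where L: "(\<lambda>k. (dist (x k) z)\<^sup>2) \<longlonglongrightarrow> L"
    by (rule decseq_convergent[of _ 0]) auto
  \<comment> \<open>A convergent sequence and its shift by one have the same limit, so the decreases
    vanish; they dominate the squared steps.\<close>
  have "(\<lambda>k. (dist (x k) z)\<^sup>2 - (dist (x (Suc k)) z)\<^sup>2) \<longlonglongrightarrow> 0"
    using tendsto_diff[OF L LIMSEQ_Suc[OF L]] by simp
  then have "(\<lambda>k. (dist (x k) (x (Suc k)))\<^sup>2) \<longlonglongrightarrow> 0"
  proof (rule tendsto_sandwich[OF _ _ tendsto_const, rotated 2])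
    show "\<forall>\<^sub>F k in sequentially.
        (dist (x k) (x (Suc k)))\<^sup>2 \<le> (dist (x k) z)\<^sup>2 - (dist (x (Suc k)) z)\<^sup>2"
      using decrease[OF z] by (intro always_eventually allI) (simp add: le_diff_eq add.commute)
  qed auto
  then have step: "(\<lambda>k. dist (x k) (x (Suc k))) \<longlonglongrightarrow> 0"
    by simp
  have cluster: "l \<in> (\<Inter>i\<in>{1..m}. U i)"
    if r: "strict_mono r" and l: "(x \<circ> r) \<longlonglongrightarrow> l" for r l
  proof
    fix i assume i: "i \<in> {1..m}"
    define p where "p k = closest_point (U i) (x k)" for k
    have "(\<lambda>k. dist (x k) (p k)) \<longlonglongrightarrow> 0"
      using dist_threePM_closest_point_le[OF assms(3-5) i, of x1]
      by (intro tendsto_sandwich[OF _ _ tendsto_const step] always_eventually allI)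
        \<comment> \<open>The recursion stays folded so that the next iterate matches the one in
          \<open>step\<close>.\<close>
        (simp_all add: x_def p_def del: threePM_seq.simps)
    then have "(\<lambda>k. x k - p k) \<longlonglongrightarrow> 0"
      by (simp add: dist_norm tendsto_norm_zero_iff)
    then have "(\<lambda>k. x (r k) - p (r k)) \<longlonglongrightarrow> 0"
      by (rule LIMSEQ_subseq_LIMSEQ[OF _ r, unfolded o_def])
    \<comment> \<open>Subtracting the vanishing gap shows that the projections, which lie in the
      closed set \<open>U i\<close>, also tend to \<open>l\<close>.\<close>
    then have "(\<lambda>k. (x \<circ> r) k - (x (r k) - p (r k))) \<longlonglongrightarrow> l - 0"
      by (intro tendsto_diff l)
    then have "(\<lambda>k. p (r k)) \<longlonglongrightarrow> l"
      by simp
    moreover have "p (r k) \<in> U i" for k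
      unfolding p_def using assms(2,3) i by (intro closest_point_in_set) auto
    ultimately show "l \<in> U i"
      by (rule closed_sequentially[OF assms(3)[OF i], rotated])
  qed
  \<comment> \<open>Drop the squared step from \<open>decrease\<close> and take square
    roots.\<close>
  have Fejer: "dist (x (Suc k)) w \<le> dist (x k) w" if "w \<in> (\<Inter>i\<in>{1..m}. U i)" for w k
  proof (rule power2_le_imp_le)
    show "(dist (x (Suc k)) w)\<^sup>2 \<le> (dist (x k) w)\<^sup>2"
      using decrease[OF that, of k] zero_le_power2[of "dist (x k) (x (Suc k))"] by linarith
  qed simp
  show ?thesis
    unfolding x_def[symmetric] using z Fejer cluster by (rule Fejer_monotone_tendsto)
qed

end
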